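(* For every integer $m\ge 0$, $$S_m(x,y,z)=\sum_{T\in\mathcal{T}_m}x^{\mathsf{ee}(T)}y^{\mathsf{oe}(T)}z^{\mathsf{odd}(T)}.$$ Equivalently, writing $S_{2m}(x,y,z)=\sum_{i,j\ge0}s_{2m,i,j}\,x^{2i+1}y^{2j}z^{2m-2i-2j}$ and $S_{2m+1}(x,y,z)=\sum_{i,j\ge0}s_{2m+1,i,j}\,x^{2i}y^{2j+1}z^{2m+1-2i-2j}$, the coefficient $s_{m,i,j}$ equals the number of trees $T\in\mathcal{T}_m$ with $\lfloor\mathsf{ee}(T)/2\rfloor=i$ and $\lfloor\mathsf{oe}(T)/2\rfloor=j$.
   Context: Let $D$ be the derivation on the polynomial ring $\mathbb{Z}[x,y,z]$ (linear and satisfying $D(uv)=D(u)v+uD(v)$) determined by $D(x)=yz$, $D(y)=xz$, $D(z)=xy$. The $m$-th Schett polynomial is $S_m(x,y,z)=D^m(x)$. $\mathcal{T}_m$ denotes the set of increasing trees on $\{1,\dots,m\}$: plane trees (rooted trees whose children at each node are linearly ordered left to right) with $m+1$ nodes labeled bijectively by $0,1,\dots,m$ such that labels increase along every root-to-leaf path and the labels of the children of each node increase from left to right. The degree of a node is its number of children; the level of a node is its distance from the root (root at level $0$). $\mathsf{ee}(T)$ is the number of even-degree nodes on even levels, $\mathsf{oe}(T)$ the number of even-degree nodes on odd levels, and $\mathsf{odd}(T)$ the number of odd-degree nodes of $T$. *)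

theory Defs
  imports Complex_Main "HOL-Library.Poly_Mapping"
begin

section \<open>The ring \<open>\<int>[x,y,z]\<close> and the Schett polynomials\<close>

datatype indet = Ix | Iy | Iz

type_synonym zpoly = "(indet \<Rightarrow>\<^sub>0 nat) \<Rightarrow>\<^sub>0 int"

definition Var :: "indet \<Rightarrow> zpoly" where
  "Var v = Poly_Mapping.single (Poly_Mapping.single v 1) 1"

definition monom_exp :: "nat \<Rightarrow> nat \<Rightarrow> nat \<Rightarrow> (indet \<Rightarrow>\<^sub>0 nat)" where
  "monom_exp a b c =
     Poly_Mapping.single Ix a + Poly_Mapping.single Iy b + Poly_Mapping.single Iz c"

definition derivation :: "(zpoly \<Rightarrow> zpoly) \<Rightarrow> bool" where
  "derivation d \<longleftrightarrow>
     (\<forall>u v. d (u + v) = d u + d v) \<and>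
     (\<forall>c u. d (of_int c * u) = of_int c * d u) \<and>
     (\<forall>u v. d (u * v) = d u * v + u * d v)"

definition is_schett_derivation :: "(zpoly \<Rightarrow> zpoly) \<Rightarrow> bool" where
  "is_schett_derivation d \<longleftrightarrow>
     derivation d \<and>
     d (Var Ix) = Var Iy * Var Iz \<and>
     d (Var Iy) = Var Ix * Var Iz \<and>
     d (Var Iz) = Var Ix * Var Iy"

text \<open>Existence and uniqueness are shown in \<open>ex1_schett_derivation\<close> below.\<close>

definition schett_D :: "zpoly \<Rightarrow> zpoly" where
  "schett_D = (THE d. is_schett_derivation d)"

definition schett :: "nat \<Rightarrow> zpoly" where
  "schett m = (schett_D ^^ m) (Var Ix)"

text \<open>
  The coefficient \<open>s\<^sub>n\<^sub>,\<^sub>i\<^sub>,\<^sub>j\<close> of \<open>S\<^sub>n\<close>: it belongs to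
  \<open>x\<^bsup>2i+1\<^esup> y\<^bsup>2j\<^esup> z\<^bsup>n-2i-2j\<^esup>\<close> for even \<open>n\<close> and to
  \<open>x\<^bsup>2i\<^esup> y\<^bsup>2j+1\<^esup> z\<^bsup>n-2i-2j\<^esup>\<close> for odd \<open>n\<close>. It is \<open>0\<close> when the exponent of
  \<open>z\<close> would be negative; the guard excludes truncated subtraction.
\<close>

definition schett_coeff :: "nat \<Rightarrow> nat \<Rightarrow> nat \<Rightarrow> int" where
  "schett_coeff n i j =
     (if 2 * i + 2 * j \<le> n then
        Poly_Mapping.lookup (schett n)
          (if even n then monom_exp (2 * i + 1) (2 * j) (n - 2 * i - 2 * j)
           else monom_exp (2 * i) (2 * j + 1) (n - 2 * i - 2 * j))
      else 0)"

section \<open>Increasing trees\<close>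

datatype ptree = Node (root_label: nat) (children: "ptree list")

fun labels :: "ptree \<Rightarrow> nat list" where
  "labels (Node a ts) = a # concat (map labels ts)"

fun root_leaf_paths :: "ptree \<Rightarrow> nat list list" where
  "root_leaf_paths (Node a ts) =
     (if ts = [] then [[a]] else map ((#) a) (concat (map root_leaf_paths ts)))"

fun children_increasing :: "ptree \<Rightarrow> bool" where
  "children_increasing (Node a ts) \<longleftrightarrow>
     sorted_wrt (<) (map root_label ts) \<and> (\<forall>t\<in>set ts. children_increasing t)"

definition increasing_trees :: "nat \<Rightarrow> ptree set" where
  "increasing_trees m =
     {T. distinct (labels T) \<and> set (labels T) = {0..m} \<and>
         (\<forall>p\<in>set (root_leaf_paths T). sorted_wrt (<) p) \<and> children_increasing T}"

text \<open>One pair (level, degree) for every node, the root being at level \<open>l\<close>.\<close>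

fun level_degrees :: "nat \<Rightarrow> ptree \<Rightarrow> (nat \<times> nat) list" where
  "level_degrees l (Node a ts) = (l, length ts) # concat (map (level_degrees (Suc l)) ts)"

definition ee :: "ptree \<Rightarrow> nat" where
  "ee T = length (filter (\<lambda>(l, d). even d \<and> even l) (level_degrees 0 T))"

definition oe :: "ptree \<Rightarrow> nat" where
  "oe T = length (filter (\<lambda>(l, d). even d \<and> odd l) (level_degrees 0 T))"

definition odd_nodes :: "ptree \<Rightarrow> nat" where
  "odd_nodes T = length (filter (\<lambda>(l, d). odd d) (level_degrees 0 T))"

section \<open>Well-definedness of the derivation\<close>

abbreviation (input) mon :: "(indet \<Rightarrow>\<^sub>0 nat) \<Rightarrow> zpoly" where
  "mon t \<equiv> Poly_Mapping.single t 1"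

lemma of_int_eq_single: "(of_int c :: zpoly) = Poly_Mapping.single 0 c"
proof -
  have "Poly_Mapping.single 0 (of_int c :: int) = (of_int c :: zpoly)" by (rule single_of_int)
  then show ?thesis by simp
qed

lemma of_nat_eq_single: "(of_nat c :: zpoly) = Poly_Mapping.single 0 (int c)"
  by (metis of_int_eq_single of_int_of_nat_eq)

lemma single_eq_of_int_mono: "Poly_Mapping.single t c = of_int c * mon t"
  by (simp add: of_int_eq_single mult_single)

lemma zpoly_induct [case_names add monom]:
  assumes add: "\<And>p q. P p \<Longrightarrow> P q \<Longrightarrow> P (p + q)"
    and monom: "\<And>c t. P (of_int c * mon t)"
  shows "P (p :: zpoly)"
proof -
  have *: "P (\<Sum>t\<in>A. of_int (f t) * mon t)" if "finite A" for A and f :: "_ \<Rightarrow> int"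
    using that
  proof induction
    case empty
    show ?case using monom[of 0 0] by simp
  qed (simp add: add monom)
  have "p = (\<Sum>t\<in>Poly_Mapping.keys p. of_int (Poly_Mapping.lookup p t) * mon t)"
    by (rule poly_mapping_eqI)
      (auto simp: lookup_sum single_eq_of_int_mono[symmetric] lookup_single when_def
        in_keys_iff)
  then show ?thesis using *[OF finite_keys] by metis
qed

lemma monom_eq_monom_exp:
  "t = monom_exp (Poly_Mapping.lookup t Ix) (Poly_Mapping.lookup t Iy) (Poly_Mapping.lookup t Iz)"
proof (rule poly_mapping_eqI)
  fix v show "Poly_Mapping.lookup t v = Poly_Mapping.lookup (monom_exp (Poly_Mapping.lookup t Ix)
     (Poly_Mapping.lookup t Iy) (Poly_Mapping.lookup t Iz)) v"
    by (cases v) (simp_all add: monom_exp_def lookup_add lookup_single)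
qed

lemma Var_power: "Var v ^ n = mon (Poly_Mapping.single v n)"
  by (induction n) (simp_all add: Var_def mult_single single_add[symmetric])

lemma mono_monom_exp: "mon (monom_exp a b c) = Var Ix ^ a * Var Iy ^ b * Var Iz ^ c"
  by (simp add: monom_exp_def Var_power mult_single)

definition pdiff_mono :: "indet \<Rightarrow> (indet \<Rightarrow>\<^sub>0 nat) \<Rightarrow> zpoly" where
  "pdiff_mono v t =
     of_nat (Poly_Mapping.lookup t v) * mon (t - Poly_Mapping.single v 1)"

lemma pdiff_mono_add: "pdiff_mono v (s + t) = pdiff_mono v s * mon t + mon s * pdiff_mono v t"
proof -
  have *: "of_nat (Poly_Mapping.lookup s v) * mon (s + t - Poly_Mapping.single v 1) =
      of_nat (Poly_Mapping.lookup s v) * mon (s - Poly_Mapping.single v 1) * mon t" for s t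
  proof (cases "Poly_Mapping.lookup s v = 0")
    case False
    then have "s + t - Poly_Mapping.single v 1 = s - Poly_Mapping.single v 1 + t"
      by (intro poly_mapping_eqI) (auto simp: lookup_add lookup_minus lookup_single when_def)
    then show ?thesis by (simp add: mult_single mult.assoc)
  qed simp
  show ?thesis
    using *[of s t] *[of t s]
    by (simp add: pdiff_mono_def lookup_add algebra_simps)
qed

definition pdiff :: "indet \<Rightarrow> zpoly \<Rightarrow> zpoly" where
  "pdiff v p = (\<Sum>t\<in>Poly_Mapping.keys p. of_int (Poly_Mapping.lookup p t) * pdiff_mono v t)"

lemma pdiff_superset:
  assumes "finite A" "Poly_Mapping.keys p \<subseteq> A"
  shows "pdiff v p = (\<Sum>t\<in>A. of_int (Poly_Mapping.lookup p t) * pdiff_mono v t)"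
  unfolding pdiff_def using assms
  by (intro sum.mono_neutral_left) (auto simp: in_keys_iff)

lemma pdiff_add: "pdiff v (p + q) = pdiff v p + pdiff v q"
proof -
  let ?A = "Poly_Mapping.keys p \<union> Poly_Mapping.keys q"
  have "finite ?A" by simp
  then show ?thesis
    using pdiff_superset[of ?A "p + q" v] pdiff_superset[of ?A p v] pdiff_superset[of ?A q v]
      Poly_Mapping.keys_add[of p q]
    by (simp add: lookup_add sum.distrib algebra_simps)
qed

lemma pdiff_term: "pdiff v (of_int c * mon t) = of_int c * pdiff_mono v t"
  using pdiff_superset[of "{t}" "Poly_Mapping.single t c" v]
  by (simp add: single_eq_of_int_mono[symmetric])

lemma pdiff_of_int: "pdiff v (of_int c * p) = of_int c * pdiff v p"
proof (induction p rule: zpoly_induct)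
  case (add p q)
  then show ?case by (simp add: distrib_left pdiff_add)
next
  case (monom d t)
  show ?case using pdiff_term[of v "c * d" t] pdiff_term[of v d t]
    by (simp add: mult.assoc)
qed

lemma pdiff_mult: "pdiff v (p * q) = pdiff v p * q + p * pdiff v q"
proof (induction p rule: zpoly_induct)
  case (add p p')
  then show ?case by (simp add: algebra_simps pdiff_add)
next
  case (monom c s)
  show ?case
  proof (induction q rule: zpoly_induct)
    case (add q q')
    then show ?case by (simp add: algebra_simps pdiff_add)
  next
    case (monom d t)
    have "(of_int c * mon s) * (of_int d * mon t) = of_int (c * d) * mon (s + t)"
      by (simp add: of_int_eq_single mult_single)
    then have "pdiff v ((of_int c * mon s) * (of_int d * mon t)) =
        of_int (c * d) * pdiff_mono v (s + t)"
      by (simp only: pdiff_term)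
    then show ?case by (simp add: pdiff_term pdiff_mono_add algebra_simps)
  qed
qed

lemma pdiff_Var: "pdiff v (Var w) = (if v = w then 1 else 0)"
  using pdiff_term[of v 1 "Poly_Mapping.single w 1"]
  by (auto simp: Var_def pdiff_mono_def lookup_single)

lemma ex_schett_derivation: "\<exists>d. is_schett_derivation d"
proof
  show "is_schett_derivation (\<lambda>p. Var Iy * Var Iz * pdiff Ix p
      + Var Ix * Var Iz * pdiff Iy p + Var Ix * Var Iy * pdiff Iz p)"
    unfolding is_schett_derivation_def derivation_def
    by (intro conjI allI; (simp only: pdiff_of_int)?)
      (simp_all add: pdiff_add pdiff_mult pdiff_Var algebra_simps)
qed

lemma schett_derivation_unique:
  assumes "is_schett_derivation d" "is_schett_derivation d'"
  shows "d = d'"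
proof
  have add: "d (u + v) = d u + d v" "d' (u + v) = d' u + d' v"
    and int: "d (of_int c * u) = of_int c * d u" "d' (of_int c * u) = of_int c * d' u"
    and mult: "d (u * v) = d u * v + u * d v" "d' (u * v) = d' u * v + u * d' v" for c u v
    using assms unfolding is_schett_derivation_def derivation_def by metis+
  have one: "d 1 = d' 1" using mult[of 1 1] by simp
  have var: "d (Var w) = d' (Var w)" for w
    using assms by (cases w) (simp_all add: is_schett_derivation_def)
  have pow: "d (Var w ^ n) = d' (Var w ^ n)" for w n
    by (induction n) (simp_all add: one var mult)
  have m: "d (mon t) = d' (mon t)" for t
    by (subst (1 2) monom_eq_monom_exp) (simp only: mono_monom_exp mult pow)
  show "d p = d' p" for p
    by (induction p rule: zpoly_induct) (simp_all add: add int m)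
qed

lemma ex1_schett_derivation: "\<exists>!d. is_schett_derivation d"
  using ex_schett_derivation schett_derivation_unique by blast

lemma schett_D: "is_schett_derivation schett_D"
  unfolding schett_D_def using ex1_schett_derivation by (rule theI')

section \<open>Finiteness of the set of increasing trees\<close>

lemma labels_nonempty: "length (labels T) > 0"
  by (cases T) auto

lemma finite_trees_bounded: "finite {T. length (labels T) \<le> n \<and> set (labels T) \<subseteq> {0..m}}"
proof (induction n)
  case 0
  have "{T. length (labels T) \<le> 0 \<and> set (labels T) \<subseteq> {0..m}} = {}"
    using labels_nonempty by (auto simp del: length_greater_0_conv)
  then show ?case by (simp only: finite.emptyI)
next
  case (Suc n)
  let ?B = "{T. length (labels T) \<le> n \<and> set (labels T) \<subseteq> {0..m}}"
  let ?L = "{ts. set ts \<subseteq> ?B \<and> length ts \<le> n}"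
  have "T \<in> (\<lambda>(a, ts). Node a ts) ` ({0..m} \<times> ?L)"
    if T: "length (labels T) \<le> Suc n" "set (labels T) \<subseteq> {0..m}" for T
  proof -
    obtain a ts where [simp]: "T = Node a ts" by (cases T)
    have sum: "sum_list (map (length \<circ> labels) ts) \<le> n"
      using T by (simp add: length_concat)
    have "length ts \<le> sum_list (map (length \<circ> labels) ts)" for ts
    proof (induction ts)
      case (Cons t ts)
      then show ?case using labels_nonempty[of t] by (simp del: length_greater_0_conv)
    qed simp
    then have len: "length ts \<le> n" using sum le_trans by blast
    have "length (labels t) \<le> n" if "t \<in> set ts" for t
      using member_le_sum_list[of "length (labels t)" "map (length \<circ> labels) ts"] that sum
      by force
    then have "ts \<in> ?L" using T len by auto
    then show ?thesis using T by auto
  qed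
  then have "{T. length (labels T) \<le> Suc n \<and> set (labels T) \<subseteq> {0..m}}
      \<subseteq> (\<lambda>(a, ts). Node a ts) ` ({0..m} \<times> ?L)" by blast
  moreover have "finite ?L" using finite_lists_length_le[OF Suc] .
  ultimately show ?case by (meson finite_SigmaI finite_atLeastAtMost finite_imageI finite_subset)
qed

lemma finite_increasing_trees: "finite (increasing_trees m)"
proof (rule finite_subset[OF _ finite_trees_bounded])
  show "increasing_trees m \<subseteq> {T. length (labels T) \<le> Suc m \<and> set (labels T) \<subseteq> {0..m}}"
    by (auto simp: increasing_trees_def simp flip: distinct_card)
qed

end

theory Submission
  imports Defs "HOL-Library.Multiset"
begin

text \<open>
  Every increasing tree on \<open>{1..m+1}\<close> arises from exactly one increasing tree on \<open>{1..m}\<close> by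
  attaching \<open>m+1\<close> as the last child of some node \<open>v\<close>. Give a node of odd degree the weight \<open>z\<close>,
  and a node of even degree the weight \<open>x\<close> or \<open>y\<close> according to the parity of its level. Attaching
  the new leaf flips the degree parity of \<open>v\<close> and creates an even node on the opposite level
  parity, so the weight of \<open>v\<close> changes by one of \<open>x \<rightarrow> yz\<close>, \<open>y \<rightarrow> xz\<close>, \<open>z \<rightarrow> xy\<close>. Summing over
  \<open>v\<close> is the product rule for \<open>D\<close>. The coefficient form follows because the parities of
  \<open>ee\<close> and \<open>oe\<close> are determined by the number of nodes.
\<close>

section \<open>Attaching and removing a leaf\<close>

text \<open>The recursion copies the product rule: the head of the list extends the root itself, the
  remaining entries change exactly one subtree. Lists keep the terms of that rule separate until
  they are shown to be distinct.\<close>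

fun attachments :: "nat \<Rightarrow> ptree \<Rightarrow> ptree list"
  and forest_attachments :: "nat \<Rightarrow> ptree list \<Rightarrow> ptree list list" where
  "attachments k (Node a ts) =
     Node a (ts @ [Node k []]) # map (Node a) (forest_attachments k ts)"
| "forest_attachments k [] = []"
| "forest_attachments k (t # ts) =
     map (\<lambda>t'. t' # ts) (attachments k t) @ map ((#) t) (forest_attachments k ts)"

text \<open>Left inverse of attaching a fresh leaf, used to recover the source tree.\<close>

fun remove_label :: "nat \<Rightarrow> ptree \<Rightarrow> ptree" where
  "remove_label k (Node a ts) =
     Node a (map (remove_label k) (filter (\<lambda>t. root_label t \<noteq> k) ts))"

text \<open>Local form of the path condition: each node is compared only with its children, so
  structural induction applies.\<close>

fun increasing :: "ptree \<Rightarrow> bool" where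
  "increasing (Node a ts) \<longleftrightarrow>
     sorted_wrt (<) (map root_label ts) \<and> (\<forall>t\<in>set ts. a < root_label t \<and> increasing t)"

section \<open>Increasing trees described node by node\<close>

lemma root_label_in_labels: "root_label T \<in> set (labels T)"
  by (cases T) auto

lemma root_leaf_paths_nonempty: "root_leaf_paths T \<noteq> []"
proof (induction T)
  case (Node a ts)
  then show ?case by (cases ts) auto
qed

lemma root_leaf_path_Cons: "p \<in> set (root_leaf_paths T) \<Longrightarrow> \<exists>q. p = root_label T # q"
  by (cases T) (auto split: if_splits)

lemma increasing_iff:
  "increasing T \<longleftrightarrow>
     (\<forall>p\<in>set (root_leaf_paths T). sorted_wrt (<) p) \<and> children_increasing T"
proof (induction T)
  case (Node a ts)
  \<comment> \<open>Every path of \<open>t\<close> starts with its root label and at least one path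
    exists, so by transitivity prepending \<open>a\<close> costs one comparison with that
    label.\<close>
  have sub: "(\<forall>p\<in>set (root_leaf_paths t). sorted_wrt (<) (a # p)) \<longleftrightarrow>
      a < root_label t \<and> (\<forall>p\<in>set (root_leaf_paths t). sorted_wrt (<) p)" (is "?L \<longleftrightarrow> ?R") for t
  proof
    assume ?L
    moreover obtain p where "p \<in> set (root_leaf_paths t)"
      using root_leaf_paths_nonempty[of t] by (meson last_in_set)
    ultimately show ?R using root_leaf_path_Cons[of p t] by fastforce
  next
    assume ?R
    show ?L
    proof
      fix p assume p: "p \<in> set (root_leaf_paths t)"
      then obtain q where "p = root_label t # q" using root_leaf_path_Cons by blast
      with \<open>?R\<close> p show "sorted_wrt (<) (a # p)" by fastforce
    qed
  qed
  have "(\<forall>p\<in>set (root_leaf_paths (Node a ts)). sorted_wrt (<) p) \<longleftrightarrow>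
      (\<forall>t\<in>set ts. \<forall>p\<in>set (root_leaf_paths t). sorted_wrt (<) (a # p))"
    by (cases "ts = []") auto
  then show ?case using Node sub by auto
qed

text \<open>Distinctness and the exact label set merge into one multiset equation, to which
  attaching a leaf adds a single element.\<close>

lemma increasing_trees_eq:
  "increasing_trees m = {T. mset (labels T) = mset_set {0..m} \<and> increasing T}"
proof -
  have "distinct xs \<and> set xs = {0..m} \<longleftrightarrow> mset xs = mset_set {0..m}" for xs :: "nat list"
  proof
    assume "distinct xs \<and> set xs = {0..m}"
    then show "mset xs = mset_set {0..m}" using mset_set_set by metis
  next
    assume eq: "mset xs = mset_set {0..m}"
    then have "set xs = {0..m}"
      by (metis finite_atLeastAtMost finite_set_mset_mset_set set_mset_mset)
    with eq show "distinct xs \<and> set xs = {0..m}"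
      by (metis List.finite_set distinct_count_atmost_1 count_mset_set(1,3))
  qed
  then show ?thesis by (auto simp: increasing_trees_def increasing_iff)
qed

section \<open>What attaching a leaf preserves\<close>

lemma root_label_attachments: "T' \<in> set (attachments k T) \<Longrightarrow> root_label T' = root_label T"
  by (cases T) auto

lemma length_forest_attachments: "ts' \<in> set (forest_attachments k ts) \<Longrightarrow> length ts' = length ts"
  by (induction ts arbitrary: ts') auto

lemma map_root_label_forest_attachments:
  "ts' \<in> set (forest_attachments k ts) \<Longrightarrow> map root_label ts' = map root_label ts"
  by (induction ts arbitrary: ts') (auto simp: root_label_attachments)

lemma mset_labels_attachments:
  "T' \<in> set (attachments k T) \<Longrightarrow> mset (labels T') = add_mset k (mset (labels T))"
  "ts' \<in> set (forest_attachments k ts) \<Longrightarrow>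
     mset (concat (map labels ts')) = add_mset k (mset (concat (map labels ts)))"
  by (induction k T and k ts arbitrary: T' and ts' rule: attachments_forest_attachments.induct)
    auto

text \<open>Since \<open>k\<close> exceeds all labels present, appending it as a last child respects
  parent and siblings; existing labels keep their places. In the forest part \<open>a\<close> is the
  label of the common parent.\<close>

lemma increasing_attachments:
  "T' \<in> set (attachments k T) \<Longrightarrow> increasing T \<Longrightarrow> \<forall>b\<in>set (labels T). b < k \<Longrightarrow> increasing T'"
  "ts' \<in> set (forest_attachments k ts) \<Longrightarrow> \<forall>t\<in>set ts. a < root_label t \<and> increasing t \<Longrightarrow>
     \<forall>b\<in>set (concat (map labels ts)). b < k \<Longrightarrow> \<forall>t\<in>set ts'. a < root_label t \<and> increasing t"
proof (induction k T and k ts arbitrary: T' and a ts' rule: attachments_forest_attachments.induct)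
  case (1 k a ts)
  consider "T' = Node a (ts @ [Node k []])"
    | ts' where "T' = Node a ts'" "ts' \<in> set (forest_attachments k ts)"
    using "1.prems"(1) by auto
  then show ?case
  proof cases
    case 1
    then show ?thesis using "1.prems"(2,3) root_label_in_labels
      by (fastforce simp: sorted_wrt_append)
  next
    case (2 ts')
    then show ?thesis
      using "1.IH"[of ts' a] "1.prems"(2,3) map_root_label_forest_attachments[of ts' k ts] by auto
  qed
next
  case (3 k t ts)
  have labs: "\<forall>b\<in>set (labels t). b < k" "\<forall>b\<in>set (concat (map labels ts)). b < k"
    using "3.prems"(3) by auto
  consider t' where "ts' = t' # ts" "t' \<in> set (attachments k t)"
    | us where "ts' = t # us" "us \<in> set (forest_attachments k ts)"
    using "3.prems"(1) by auto
  then show ?case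
  proof cases
    case 1
    then show ?thesis
      using "3.IH"(1)[OF 1(2) _ labs(1)] "3.prems"(2) root_label_attachments[OF 1(2)] by simp
  next
    case 2
    then show ?thesis using "3.IH"(2)[OF 2(2) _ labs(2), of a] "3.prems"(2) by simp
  qed
qed auto

section \<open>Injectivity of attachment\<close>

lemma remove_label_absent:
  "k \<notin> set (labels T) \<Longrightarrow> remove_label k T = T"
proof (induction T)
  case (Node a ts)
  have "filter (\<lambda>t. root_label t \<noteq> k) ts = ts"
    using Node.prems root_label_in_labels by (fastforce simp: filter_id_conv)
  then show ?case using Node by (auto intro!: map_idI)
qed

lemma remove_label_attachments:
  "T' \<in> set (attachments k T) \<Longrightarrow> k \<notin> set (labels T) \<Longrightarrow> remove_label k T' = T"
  "ts' \<in> set (forest_attachments k ts) \<Longrightarrow> k \<notin> set (concat (map labels ts)) \<Longrightarrow>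
     map (remove_label k) (filter (\<lambda>t. root_label t \<noteq> k) ts') = ts"
proof (induction k T and k ts arbitrary: T' and ts' rule: attachments_forest_attachments.induct)
  case (1 k a ts)
  have "remove_label k (Node a ts) = Node a ts" by (rule remove_label_absent) (use 1 in auto)
  then show ?case using 1 by auto
next
  case (3 k t ts)
  \<comment> \<open>An auxiliary root carries the rule for trees over to the forest;
    \<open>Suc k\<close> serves as a label different from \<open>k\<close>.\<close>
  have "remove_label k (Node (Suc k) (t # ts)) = Node (Suc k) (t # ts)"
    by (rule remove_label_absent) (use "3.prems" in auto)
  then have "map (remove_label k) (filter (\<lambda>t. root_label t \<noteq> k) (t # ts)) = t # ts"
    by simp
  moreover have "root_label t \<noteq> k" using "3.prems" root_label_in_labels[of t] by auto
  ultimately show ?case using 3 by (auto simp: root_label_attachments)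
qed auto

text \<open>A new child of the root changes the root's degree, while attachments further down keep
  it.\<close>

lemma distinct_attachments:
  "k \<notin> set (labels T) \<Longrightarrow> distinct (attachments k T)"
  "k \<notin> set (concat (map labels ts)) \<Longrightarrow> distinct (forest_attachments k ts)"
proof (induction k T and k ts rule: attachments_forest_attachments.induct)
  case (1 k a ts)
  then show ?case
    by (auto simp: distinct_map inj_on_def dest: length_forest_attachments)
next
  case (3 k t ts)
  \<comment> \<open>Attaching adds a label, so changing \<open>t\<close> and changing a later tree
    never yield the same forest.\<close>
  then have "t \<notin> set (attachments k t)"
    using mset_labels_attachments(1)[of t k t] by auto
  with 3 show ?case by (auto simp: distinct_map inj_on_def)
qed auto

section \<open>Surjectivity of attachment and the resulting recursion for sums\<close>

lemma forest_attachments_append: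
  "t' \<in> set (attachments k t) \<Longrightarrow> us @ t' # vs \<in> set (forest_attachments k (us @ t # vs))"
  by (induction us) auto

text \<open>The largest label sits on a leaf that is the last child of its parent, so it can be
  detached; the induction descends into the subtree containing it.\<close>

lemma increasing_imp_attachment:
  assumes "increasing T'" "k \<in> set (labels T')" "root_label T' \<noteq> k" "\<forall>b\<in>set (labels T'). b \<le> k"
  shows "\<exists>T. increasing T \<and> T' \<in> set (attachments k T)"
  using assms
proof (induction T')
  case (Node a ts)
  then obtain t where t: "t \<in> set ts" "k \<in> set (labels t)" by auto
  then obtain us vs where ts: "ts = us @ t # vs" by (meson split_list)
  show ?case
  proof (cases "root_label t = k")
    case True
    have le: "root_label s \<le> k" if "s \<in> set ts" for s
      using that Node.prems(4) root_label_in_labels[of s] by auto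
    \<comment> \<open>A sibling to the right would carry a label above the maximum
      \<open>k\<close>.\<close>
    have "vs = []"
    proof (cases vs)
      case (Cons v vs')
      then have "k < root_label v" using Node.prems(1) ts True by (auto simp: sorted_wrt_append)
      with le[of v] ts Cons show ?thesis by auto
    qed simp
    \<comment> \<open>So would a child of \<open>t\<close>.\<close>
    moreover have "t = Node k []"
    proof (cases t)
      case [simp]: (Node b ss)
      have "ss = []"
      proof (cases ss)
        case (Cons s ss')
        then have "k < root_label s" using Node.prems(1) t True by fastforce
        moreover have "root_label s \<in> set (labels t)" using Cons root_label_in_labels[of s] by simp
        ultimately show ?thesis using Node.prems(4) t(1) by fastforce
      qed simp
      then show ?thesis using True by simp
    qed
    ultimately have "Node a ts \<in> set (attachments k (Node a us))" using ts by simp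
    moreover have "increasing (Node a us)" using Node.prems(1) ts by (auto simp: sorted_wrt_append)
    ultimately show ?thesis by blast
  next
    case False
    \<comment> \<open>Now \<open>k\<close> lies strictly below the root of \<open>t\<close>; the
      reduced tree \<open>t0\<close> has the same root label, so the order among siblings
      survives.\<close>
    then obtain t0 where t0: "increasing t0" "t \<in> set (attachments k t0)"
      using Node.IH[OF t(1)] t Node.prems(1,4) by auto
    have "Node a ts \<in> set (attachments k (Node a (us @ t0 # vs)))"
      using forest_attachments_append[OF t0(2)] ts by auto
    moreover have "increasing (Node a (us @ t0 # vs))"
      using Node.prems(1) ts t0(1) root_label_attachments[OF t0(2)] by auto
    ultimately show ?thesis by blast
  qed
qed

lemma increasing_trees_0: "increasing_trees 0 = {Node 0 []}"
proof -
  have "T = Node 0 []" if "mset (labels T) = {#0#}" for T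
  proof (cases T)
    case (Node a ts)
    with that have "a = 0" "concat (map labels ts) = []" by auto
    then show ?thesis using Node labels_nonempty by (cases ts) auto
  qed
  then show ?thesis by (auto simp: increasing_trees_eq)
qed

text \<open>The attachment sets partition the next set of trees: detaching the largest label shows
  that they cover it, \<open>remove_label\<close> that they are disjoint.\<close>

lemma sum_increasing_trees_Suc:
  "(\<Sum>T\<in>increasing_trees (Suc m). f T) =
     (\<Sum>T\<in>increasing_trees m. \<Sum>T'\<leftarrow>attachments (Suc m) T. f T')"
proof -
  let ?k = "Suc m"
  have set_labels: "set (labels T) = {0..m}" if "mset (labels T) = mset_set {0..m}" for T m
    using that by (metis finite_atLeastAtMost finite_set_mset_mset_set set_mset_mset)
  have mset_Suc: "mset_set {0..Suc m} = add_mset ?k (mset_set {0..m})"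
    by (simp add: atLeastAtMostSuc_conv)
  have fresh: "?k \<notin> set (labels T)" if "T \<in> increasing_trees m" for T
    using that set_labels by (auto simp: increasing_trees_eq)
  have "increasing_trees (Suc m) = (\<Union>T\<in>increasing_trees m. set (attachments ?k T))"
  proof (intro set_eqI iffI)
    fix T' assume T': "T' \<in> increasing_trees (Suc m)"
    then have labs: "mset (labels T') = mset_set {0..Suc m}" and inc: "increasing T'"
      by (auto simp: increasing_trees_eq)
    \<comment> \<open>A root labelled \<open>?k\<close> could have no children, leaving no place for
      the label 0.\<close>
    have "root_label T' \<noteq> ?k"
    proof
      assume eq: "root_label T' = ?k"
      obtain a ts where [simp]: "T' = Node a ts" by (cases T')
      from eq have [simp]: "a = ?k" by simp
      have "ts = []"
      proof (cases ts)
        case (Cons t us)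
        then have "?k < root_label t" using inc by simp
        moreover have "root_label t \<in> set (labels T')"
          using Cons root_label_in_labels[of t] by simp
        ultimately show ?thesis
          unfolding set_labels[OF labs] by simp
      qed simp
      then have "set (labels T') = {?k}" by simp
      moreover have "0 \<in> set (labels T')" unfolding set_labels[OF labs] by simp
      ultimately show False by (metis singletonD nat.distinct(1))
    qed
    then obtain T where T: "increasing T" "T' \<in> set (attachments ?k T)"
      using increasing_imp_attachment[OF inc, of ?k] set_labels[OF labs] by auto
    with labs have "T \<in> increasing_trees m"
      using mset_labels_attachments(1)[OF T(2)] by (simp add: increasing_trees_eq mset_Suc)
    with T show "T' \<in> (\<Union>T\<in>increasing_trees m. set (attachments ?k T))" by blast
  next
    fix T' assume "T' \<in> (\<Union>T\<in>increasing_trees m. set (attachments ?k T))"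
    then obtain T where T: "T \<in> increasing_trees m" "T' \<in> set (attachments ?k T)" by blast
    then have "\<forall>b\<in>set (labels T). b < ?k"
      using set_labels[of T m] by (auto simp: increasing_trees_eq)
    then show "T' \<in> increasing_trees (Suc m)"
      using T increasing_attachments(1)[OF T(2)] mset_labels_attachments(1)[OF T(2)] mset_Suc
      by (simp add: increasing_trees_eq)
  qed
  \<comment> \<open>Two trees sharing an attachment coincide, because removing the fresh label
    \<open>?k\<close> recovers both.\<close>
  also have "(\<Sum>T\<in>\<dots>. f T) = (\<Sum>T\<in>increasing_trees m. \<Sum>T'\<in>set (attachments ?k T). f T')"
    by (rule sum.UNION_disjoint)
      (auto simp: finite_increasing_trees, metis fresh remove_label_attachments(1))
  also have "\<dots> = (\<Sum>T\<in>increasing_trees m. \<Sum>T'\<leftarrow>attachments (Suc m) T. f T')"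
    by (intro sum.cong refl) (simp add: sum_list_distinct_conv_sum_set distinct_attachments fresh)
  finally show ?thesis .
qed

section \<open>The weight of a tree under the derivation\<close>

definition node_weight :: "nat \<Rightarrow> nat \<Rightarrow> zpoly" where
  "node_weight l d = (if odd d then Var Iz else if even l then Var Ix else Var Iy)"

fun weight :: "nat \<Rightarrow> ptree \<Rightarrow> zpoly" where
  "weight l (Node a ts) = node_weight l (length ts) * prod_list (map (weight (Suc l)) ts)"

lemma schett_D_add: "schett_D (u + v) = schett_D u + schett_D v"
  and schett_D_mult: "schett_D (u * v) = schett_D u * v + u * schett_D v"
  using schett_D by (auto simp: is_schett_derivation_def derivation_def)

lemma schett_D_Var:
  "schett_D (Var Ix) = Var Iy * Var Iz"
  "schett_D (Var Iy) = Var Ix * Var Iz"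
  "schett_D (Var Iz) = Var Ix * Var Iy"
  using schett_D by (auto simp: is_schett_derivation_def)

lemma schett_D_0: "schett_D 0 = 0"
  using schett_D_add[of 0 0] by simp

lemma schett_D_1: "schett_D 1 = 0"
  using schett_D_mult[of 1 1] by simp

lemma schett_D_sum: "schett_D (\<Sum>x\<in>A. f x) = (\<Sum>x\<in>A. schett_D (f x))"
  by (induction A rule: infinite_finite_induct) (simp_all add: schett_D_0 schett_D_add)

text \<open>All three rules for D in one formula: the first factor is the node after gaining a
  child, the second is the new leaf one level below.\<close>

lemma schett_D_node_weight:
  "schett_D (node_weight l d) = node_weight l (Suc d) * node_weight (Suc l) 0"
  by (simp add: node_weight_def schett_D_Var mult_ac)

text \<open>The product rule and \<open>attachments\<close> recurse alike, differentiating either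
  the root factor or one subtree. Weights depend on the shape alone, so any label \<open>k\<close>
  may be attached.\<close>

lemma schett_D_weight:
  "schett_D (weight l T) = (\<Sum>T'\<leftarrow>attachments k T. weight l T')"
  "schett_D (prod_list (map (weight l) ts)) =
     (\<Sum>ts'\<leftarrow>forest_attachments k ts. prod_list (map (weight l) ts'))"
proof (induction k T and k ts arbitrary: l and l rule: attachments_forest_attachments.induct)
  case (1 k a ts)
  \<comment> \<open>Attaching inside a child leaves the root's degree unchanged, so its factor comes
    out of the sum.\<close>
  have "(\<Sum>ts'\<leftarrow>forest_attachments k ts.
        node_weight l (length ts') * prod_list (map (weight (Suc l)) ts')) =
      (\<Sum>ts'\<leftarrow>forest_attachments k ts.
        node_weight l (length ts) * prod_list (map (weight (Suc l)) ts'))"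
    by (intro arg_cong[where f = sum_list] map_cong refl) (simp add: length_forest_attachments)
  then show ?case
    using 1[of "Suc l"]
    by (simp add: schett_D_mult schett_D_node_weight sum_list_const_mult comp_def mult_ac)
next
  case (3 k t ts)
  then show ?case
    by (simp add: schett_D_mult sum_list_const_mult sum_list_mult_const comp_def)
qed (simp_all add: schett_D_1)

lemma schett_eq_sum_weight: "schett m = (\<Sum>T\<in>increasing_trees m. weight 0 T)"
proof (induction m)
  case 0
  then show ?case by (simp add: schett_def increasing_trees_0 node_weight_def)
next
  case (Suc m)
  have "schett (Suc m) = schett_D (schett m)" by (simp add: schett_def)
  also have "\<dots> = (\<Sum>T\<in>increasing_trees (Suc m). weight 0 T)"
    by (simp only: Suc schett_D_sum schett_D_weight(1)[where k = "Suc m"] sum_increasing_trees_Suc)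
  finally show ?case .
qed

section \<open>Node statistics\<close>

lemma weight_eq_prod_level_degrees:
  "weight l T = (\<Prod>(l, d)\<leftarrow>level_degrees l T. node_weight l d)"
proof (induction T arbitrary: l)
  case (Node a ts)
  have "prod_list (map (weight (Suc l)) ts) =
      (\<Prod>(l, d)\<leftarrow>concat (map (level_degrees (Suc l)) ts). node_weight l d)"
    using Node by (induction ts) auto
  then show ?case by simp
qed

lemma prod_node_weight:
  "(\<Prod>(l, d)\<leftarrow>xs. node_weight l d) =
     Var Ix ^ length (filter (\<lambda>(l, d). even d \<and> even l) xs) *
     Var Iy ^ length (filter (\<lambda>(l, d). even d \<and> odd l) xs) *
     Var Iz ^ length (filter (\<lambda>(l, d). odd d) xs)"
  by (induction xs) (auto simp: node_weight_def mult_ac)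

lemma weight_0_eq: "weight 0 T = Var Ix ^ ee T * Var Iy ^ oe T * Var Iz ^ odd_nodes T"
  by (simp add: weight_eq_prod_level_degrees prod_node_weight ee_def oe_def odd_nodes_def)

lemma schett_eq_sum_trees:
  "schett m = (\<Sum>T\<in>increasing_trees m. Var Ix ^ ee T * Var Iy ^ oe T * Var Iz ^ odd_nodes T)"
  by (simp add: schett_eq_sum_weight weight_0_eq)

section \<open>Node counts and their parities\<close>

lemma length_level_degrees: "length (level_degrees l T) = length (labels T)"
proof (induction T arbitrary: l)
  case (Node a ts)
  then have "map (length \<circ> level_degrees (Suc l)) ts = map (length \<circ> labels) ts" by auto
  then have "sum_list (map (length \<circ> level_degrees (Suc l)) ts) =
      sum_list (map (length \<circ> labels) ts)" by (rule arg_cong)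
  then show ?case by (simp only: level_degrees.simps labels.simps list.size length_concat map_map)
qed

lemma ee_oe_odd_nodes: "ee T + oe T + odd_nodes T = length (labels T)"
proof -
  have "length (filter (\<lambda>(l, d). even d \<and> even l) xs) +
      length (filter (\<lambda>(l, d). even d \<and> odd l) xs) +
      length (filter (\<lambda>(l, d). odd d) xs) = length xs" for xs :: "(nat \<times> nat) list"
    by (induction xs) auto
  then show ?thesis by (simp add: ee_def oe_def odd_nodes_def length_level_degrees)
qed

text \<open>The shift \<open>q\<close> treats both statistics at once: at \<open>l = 0\<close>,
  \<open>q = 0\<close> counts even-degree nodes on even levels and \<open>q = 1\<close> those on odd
  levels.\<close>

lemma even_degree_level_parity:
  fixes q :: nat
  shows "even (length (filter (\<lambda>(l, d). even d \<and> even (l + q)) (level_degrees l T)) +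
     length (labels T) + l + q)"
proof (induction T arbitrary: l)
  case (Node a ts)
  let ?n = "\<lambda>xs. length (filter (\<lambda>(l, d). even d \<and> even (l + q)) xs)"
  \<comment> \<open>Each child subtree starts at level \<open>Suc l\<close>, so the offset
    \<open>Suc l + q\<close> occurs once per child.\<close>
  have "even (?n (concat (map (level_degrees (Suc l)) ts)) +
      length (concat (map labels ts)) + length ts * (Suc l + q))"
    using Node
  proof (induction ts)
    case (Cons t ts)
    have "even (?n (level_degrees (Suc l) t) + length (labels t) + Suc l + q)"
      using Cons.prems[of t "Suc l"] by (simp only: list.set_intros)
    moreover have "even (?n (concat (map (level_degrees (Suc l)) ts)) +
        length (concat (map labels ts)) + length ts * (Suc l + q))"
      using Cons by simp
    ultimately have "even (?n (level_degrees (Suc l) t) + length (labels t) + Suc l + q +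
        (?n (concat (map (level_degrees (Suc l)) ts)) +
        length (concat (map labels ts)) + length ts * (Suc l + q)))" by (rule dvd_add)
    also have "?n (level_degrees (Suc l) t) + length (labels t) + Suc l + q +
        (?n (concat (map (level_degrees (Suc l)) ts)) +
        length (concat (map labels ts)) + length ts * (Suc l + q)) =
      ?n (concat (map (level_degrees (Suc l)) (t # ts))) +
        length (concat (map labels (t # ts))) + length (t # ts) * (Suc l + q)"
      by (simp add: algebra_simps)
    finally show ?case .
  qed simp
  \<comment> \<open>If \<open>l + q\<close> is odd, the root is not counted and the product term is
    even. If \<open>l + q\<close> is even, the product has the parity of \<open>length ts\<close>,
    and the root is counted exactly when that is even.\<close>
  then show ?case by auto
qed

lemma
  assumes "T \<in> increasing_trees m"
  shows ee_oe_odd_nodes_increasing: "ee T + oe T + odd_nodes T = Suc m"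
    and even_ee_iff: "even (ee T) \<longleftrightarrow> odd m"
    and even_oe_iff: "even (oe T) \<longleftrightarrow> even m"
proof -
  have len: "length (labels T) = Suc m"
    using assms distinct_card[of "labels T"] by (simp add: increasing_trees_def)
  then show "ee T + oe T + odd_nodes T = Suc m" by (simp add: ee_oe_odd_nodes)
  show "even (ee T) \<longleftrightarrow> odd m"
    using even_degree_level_parity[of 0 0 T] len by (simp add: ee_def)
  show "even (oe T) \<longleftrightarrow> even m"
    using even_degree_level_parity[of 1 0 T] len by (simp add: oe_def)
qed

section \<open>Coefficients\<close>

lemma monom_exp_eq_iff:
  "monom_exp a b c = monom_exp a' b' c' \<longleftrightarrow> a = a' \<and> b = b' \<and> c = c'"
proof
  assume "monom_exp a b c = monom_exp a' b' c'"
  then have "Poly_Mapping.lookup (monom_exp a b c) v = Poly_Mapping.lookup (monom_exp a' b' c') v"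
    for v by simp
  from this[of Ix] this[of Iy] this[of Iz] show "a = a' \<and> b = b' \<and> c = c'"
    by (simp add: monom_exp_def lookup_add lookup_single)
qed simp

text \<open>Different exponent triples give different monomials, so each tree contributes 1 to
  exactly one coefficient.\<close>

lemma lookup_schett:
  "Poly_Mapping.lookup (schett n) (monom_exp a b c) =
     int (card {T \<in> increasing_trees n. ee T = a \<and> oe T = b \<and> odd_nodes T = c})"
proof -
  have "Poly_Mapping.lookup (schett n) (monom_exp a b c) =
      (\<Sum>T\<in>increasing_trees n. if ee T = a \<and> oe T = b \<and> odd_nodes T = c then 1 else 0)"
    by (simp add: schett_eq_sum_trees lookup_sum lookup_single when_def monom_exp_eq_iff
        eq_commute[of a] eq_commute[of b] eq_commute[of c] flip: mono_monom_exp)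
  also have "\<dots> = int (card {T \<in> increasing_trees n. ee T = a \<and> oe T = b \<and> odd_nodes T = c})"
    by (simp add: finite_increasing_trees flip: sum.inter_filter)
  finally show ?thesis .
qed

text \<open>With the parities known, the halves determine \<open>ee\<close> and \<open>oe\<close>,
  and the node count then fixes \<open>odd_nodes\<close>.\<close>

lemma schett_coeff_eq_card:
  "schett_coeff n i j = int (card {T \<in> increasing_trees n. ee T div 2 = i \<and> oe T div 2 = j})"
proof (cases "2 * i + 2 * j \<le> n")
  case True
  define a b where "a = (if even n then 2 * i + 1 else 2 * i)"
    and "b = (if even n then 2 * j else 2 * j + 1)"
  \<comment> \<open>In both cases \<open>a + b = 2 * i + 2 * j + 1\<close>, which leaves
    \<open>n - 2 * i - 2 * j\<close> of the \<open>n + 1\<close> nodes; the case assumption rules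
    out truncation.\<close>
  have "ee T = a \<and> oe T = b \<and> odd_nodes T = n - 2 * i - 2 * j \<longleftrightarrow>
      ee T div 2 = i \<and> oe T div 2 = j" if T: "T \<in> increasing_trees n" for T
    using ee_oe_odd_nodes_increasing[OF T] even_ee_iff[OF T] even_oe_iff[OF T] True
    unfolding a_def b_def by (cases "even n") (auto elim!: evenE oddE)
  then have "{T \<in> increasing_trees n. ee T = a \<and> oe T = b \<and> odd_nodes T = n - 2 * i - 2 * j} =
      {T \<in> increasing_trees n. ee T div 2 = i \<and> oe T div 2 = j}" by blast
  moreover have "schett_coeff n i j =
      Poly_Mapping.lookup (schett n) (monom_exp a b (n - 2 * i - 2 * j))"
    using True by (simp add: schett_coeff_def a_def b_def)
  ultimately show ?thesis by (simp add: lookup_schett)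
next
  case False
  \<comment> \<open>Such a tree would have \<open>ee T + oe T = 2 * i + 2 * j + 1\<close>, more than
    its \<open>n + 1\<close> nodes; this agrees with the default coefficient 0.\<close>
  have "\<not> (ee T div 2 = i \<and> oe T div 2 = j)" if T: "T \<in> increasing_trees n" for T
    using ee_oe_odd_nodes_increasing[OF T] even_ee_iff[OF T] even_oe_iff[OF T] False
    by (cases "even n") (auto elim!: evenE oddE)
  then have "{T \<in> increasing_trees n. ee T div 2 = i \<and> oe T div 2 = j} = {}" by blast
  then have "card {T \<in> increasing_trees n. ee T div 2 = i \<and> oe T div 2 = j} = 0"
    by (simp only: card.empty)
  then show ?thesis using False by (simp add: schett_coeff_def)
qed

text \<open>Trees are grouped by the two halves. Keeping the exponents as functions
  \<open>a\<close>, \<open>b\<close>, \<open>c\<close> of the halves lets one argument serve both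
  parities of \<open>n\<close>.\<close>

lemma schett_expansion:
  assumes "\<And>T. T \<in> increasing_trees n \<Longrightarrow>
    ee T = a (ee T div 2) \<and> oe T = b (oe T div 2) \<and>
    odd_nodes T = c (ee T div 2) (oe T div 2) \<and> ee T div 2 + oe T div 2 \<le> m"
  shows "schett n = (\<Sum>(i, j)\<in>{(i, j). i + j \<le> m}. of_int (schett_coeff n i j) *
    (Var Ix ^ a i * Var Iy ^ b j * Var Iz ^ c i j))"
proof -
  let ?P = "{(i, j). i + j \<le> m}" and ?g = "\<lambda>T. (ee T div 2, oe T div 2)"
  let ?mono = "\<lambda>(i, j). Var Ix ^ a i * Var Iy ^ b j * Var Iz ^ c i j"
  have "?P \<subseteq> {..m} \<times> {..m}" by auto
  then have fin: "finite ?P" by (rule finite_subset) simp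
  have "schett n = (\<Sum>T\<in>increasing_trees n. ?mono (?g T))"
    unfolding schett_eq_sum_trees
    by (intro sum.cong refl) (simp, metis assms)
  also have "\<dots> = (\<Sum>p\<in>?P. \<Sum>T\<in>{T \<in> increasing_trees n. ?g T = p}. ?mono (?g T))"
    by (rule sum.group[symmetric]) (use fin finite_increasing_trees assms in auto)
  \<comment> \<open>The monomial is constant on each fibre of \<open>?g\<close>.\<close>
  also have "\<dots> = (\<Sum>p\<in>?P. of_nat (card {T \<in> increasing_trees n. ?g T = p}) * ?mono p)"
    by (intro sum.cong refl) simp
  also have "\<dots> = (\<Sum>(i, j)\<in>?P. of_int (schett_coeff n i j) *
      (Var Ix ^ a i * Var Iy ^ b j * Var Iz ^ c i j))"
    by (intro sum.cong refl) (auto simp: schett_coeff_eq_card)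
  finally show ?thesis .
qed

theorem theorem1p6:
  fixes m :: nat
  shows "schett m =
      (\<Sum>T\<in>increasing_trees m. Var Ix ^ ee T * Var Iy ^ oe T * Var Iz ^ odd_nodes T)
    \<and> schett (2 * m) =
      (\<Sum>(i, j)\<in>{(i, j). i + j \<le> m}. of_int (schett_coeff (2 * m) i j) *
         (Var Ix ^ (2 * i + 1) * Var Iy ^ (2 * j) * Var Iz ^ (2 * m - 2 * i - 2 * j)))
    \<and> schett (2 * m + 1) =
      (\<Sum>(i, j)\<in>{(i, j). i + j \<le> m}. of_int (schett_coeff (2 * m + 1) i j) *
         (Var Ix ^ (2 * i) * Var Iy ^ (2 * j + 1) * Var Iz ^ (2 * m + 1 - 2 * i - 2 * j)))
    \<and> (\<forall>i j. schett_coeff m i j =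
      int (card {T \<in> increasing_trees m. ee T div 2 = i \<and> oe T div 2 = j}))"
proof (intro conjI allI)
  show "schett (2 * m) =
      (\<Sum>(i, j)\<in>{(i, j). i + j \<le> m}. of_int (schett_coeff (2 * m) i j) *
         (Var Ix ^ (2 * i + 1) * Var Iy ^ (2 * j) * Var Iz ^ (2 * m - 2 * i - 2 * j)))"
  proof (rule schett_expansion)
    fix T assume T: "T \<in> increasing_trees (2 * m)"
    have "odd (ee T)" "even (oe T)" using even_ee_iff[OF T] even_oe_iff[OF T] by simp_all
    \<comment> \<open>The bound comes from \<open>ee T + oe T \<le> 2 * m + 1\<close>, where the odd
      summand absorbs the 1.\<close>
    then show "ee T = 2 * (ee T div 2) + 1 \<and> oe T = 2 * (oe T div 2) \<and>
        odd_nodes T = 2 * m - 2 * (ee T div 2) - 2 * (oe T div 2) \<and>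
        ee T div 2 + oe T div 2 \<le> m"
      using ee_oe_odd_nodes_increasing[OF T] by (auto elim!: oddE evenE)
  qed
  show "schett (2 * m + 1) =
      (\<Sum>(i, j)\<in>{(i, j). i + j \<le> m}. of_int (schett_coeff (2 * m + 1) i j) *
         (Var Ix ^ (2 * i) * Var Iy ^ (2 * j + 1) * Var Iz ^ (2 * m + 1 - 2 * i - 2 * j)))"
  proof (rule schett_expansion)
    fix T assume T: "T \<in> increasing_trees (2 * m + 1)"
    have "even (ee T)" "odd (oe T)" using even_ee_iff[OF T] even_oe_iff[OF T] by simp_all
    \<comment> \<open>Here there are \<open>2 * m + 2\<close> nodes, but \<open>ee T + oe T\<close>
      is odd and hence at most \<open>2 * m + 1\<close>.\<close>
    then show "ee T = 2 * (ee T div 2) \<and> oe T = 2 * (oe T div 2) + 1 \<and>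
        odd_nodes T = 2 * m + 1 - 2 * (ee T div 2) - 2 * (oe T div 2) \<and>
        ee T div 2 + oe T div 2 \<le> m"
      using ee_oe_odd_nodes_increasing[OF T] by (auto elim!: oddE evenE)
  qed
qed (rule schett_eq_sum_trees schett_coeff_eq_card)+

end
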